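(* Let $\mathcal{H}$ be a real Hilbert space and let $f:\mathcal{H}\to\mathbb{R}$ be convex and continuously differentiable with $\operatorname{argmin} f\ne\emptyset$. Let $t_0\ge 0$, $\lambda>0$, and let $b:[t_0,+\infty)\to(0,+\infty)$ be differentiable and nondecreasing with $\sup_{t\ge t_0}\frac{\dot b(t)}{b(t)}<\lambda$. Let $y:[t_0,+\infty)\to\mathcal{H}$ be a solution of $$\ddot y(t)+\lambda\dot y(t)+b(t)\nabla f(y(t))=0\quad\text{for } t\ge t_0,$$ and set, for $t\ge t_0$, $$W(t):=\bigl(f(y(t))-\inf\nolimits_{\mathcal{H}}f\bigr)+\frac{1}{2b(t)}\|\dot y(t)\|^2 .$$ Then the following statements are true. (i) As $t\to+\infty$, $$W(t)=o\left(\frac{1}{\int_{\frac{t+t_0}{2}}^{t}b(r)\,dr}\right);$$ in particular, as $t\to+\infty$, $$f(y(t))-\inf\nolimits_{\mathcal{H}}f=o\left(\frac{1}{\int_{\frac{t+t_0}{2}}^{t}b(r)\,dr}\right)\quad\text{and}\quad \|\dot y(t)\|=o\left(\sqrt{\frac{b(t)}{\int_{\frac{t+t_0}{2}}^{t}b(r)\,dr}}\right).$$ (ii) $y(t)$ converges weakly to an element of $\operatorname{argmin} f$ as $t\to+\infty$.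
   Context: A solution is a twice continuously differentiable function $y:[t_0,+\infty)\to\mathcal{H}$ satisfying the equation for every $t\ge t_0$ (derivatives at $t_0$ are one-sided). *)

theory Defs
  imports "HOL-Analysis.Analysis" "HOL-Library.Landau_Symbols"
begin

text \<open>
  Real Hilbert spaces are types of sort \<open>{real_inner, complete_space}\<close>.
\<close>

definition continuously_differentiable :: "('h::real_normed_vector \<Rightarrow> real) \<Rightarrow> bool" where
  "continuously_differentiable f \<longleftrightarrow>
     (\<exists>f' :: 'h \<Rightarrow> ('h \<Rightarrow>\<^sub>L real).
        (\<forall>x. (f has_derivative blinfun_apply (f' x)) (at x)) \<and> continuous_on UNIV f')"

text \<open>
  On a Hilbert space the gradient exists (by the Riesz representation theorem) and is unique
  wherever \<open>f\<close> is Frechet differentiable; elsewhere the value below is unspecified.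
\<close>

definition gradient :: "('h::real_inner \<Rightarrow> real) \<Rightarrow> 'h \<Rightarrow> 'h" where
  "gradient f x = (THE g. GDERIV f x :> g)"

definition argmin_set :: "('h \<Rightarrow> real) \<Rightarrow> 'h set" where
  "argmin_set f = {x. is_arg_min f (\<lambda>_. True) x}"

text \<open>
  A map on \<open>[t0, \<infinity>)\<close> is a total function on the reals of which only the restriction to
  \<open>{t0..}\<close> matters.  The derivative is taken within \<open>{t0..}\<close>, so it is one-sided at \<open>t0\<close> and
  the ordinary derivative at every \<open>t > t0\<close>.
\<close>

definition time_deriv :: "real \<Rightarrow> (real \<Rightarrow> 'a::real_normed_vector) \<Rightarrow> real \<Rightarrow> 'a" where
  "time_deriv t0 y t = vector_derivative y (at t within {t0..})"

definition twice_continuously_differentiable ::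
    "real \<Rightarrow> (real \<Rightarrow> 'a::real_normed_vector) \<Rightarrow> bool" where
  "twice_continuously_differentiable t0 y \<longleftrightarrow>
     y differentiable_on {t0..} \<and>
     time_deriv t0 y differentiable_on {t0..} \<and>
     continuous_on {t0..} (time_deriv t0 (time_deriv t0 y))"

definition is_solution ::
    "('h::real_inner \<Rightarrow> real) \<Rightarrow> real \<Rightarrow> (real \<Rightarrow> real) \<Rightarrow> real \<Rightarrow> (real \<Rightarrow> 'h) \<Rightarrow> bool" where
  "is_solution f lam b t0 y \<longleftrightarrow>
     twice_continuously_differentiable t0 y \<and>
     (\<forall>t\<ge>t0. time_deriv t0 (time_deriv t0 y) t + lam *\<^sub>R time_deriv t0 y t
               + b t *\<^sub>R gradient f (y t) = 0)"

definition energy ::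
    "('h::real_inner \<Rightarrow> real) \<Rightarrow> (real \<Rightarrow> real) \<Rightarrow> real \<Rightarrow> (real \<Rightarrow> 'h) \<Rightarrow> real \<Rightarrow> real" where
  "energy f b t0 y t =
     (f (y t) - (INF x. f x)) + 1 / (2 * b t) * (norm (time_deriv t0 y t))\<^sup>2"

definition weakly_tendsto ::
    "('b \<Rightarrow> 'h::real_normed_vector) \<Rightarrow> 'h \<Rightarrow> 'b filter \<Rightarrow> bool" where
  "weakly_tendsto y x F \<longleftrightarrow>
     (\<forall>\<phi>::'h \<Rightarrow> real. bounded_linear \<phi> \<longrightarrow> ((\<lambda>t. \<phi> (y t)) \<longlongrightarrow> \<phi> x) F)"

end

theory Submission
  imports Defs
begin

text \<open>
  Fix a minimizer \<open>z\<close>, write \<open>u\<close> for the velocity and choose \<open>m > 0\<close> with \<open>sup b'/b \<le> m < lam\<close>.  With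
  \<open>H = \<langle>u, y - z\<rangle> + lam/2 \<parallel>y - z\<parallel>\<^sup>2\<close>, the function \<open>G = b W + m H\<close> is nonnegative and satisfies
  \<open>G' \<le> - (lam - m) \<parallel>u\<parallel>\<^sup>2\<close>, and a suitable combination \<open>K\<close> of \<open>G\<close> and \<open>H\<close> is nonnegative with
  \<open>K' \<le> - b W\<close>.  Since \<open>W\<close> decreases, \<open>W t\<close> times the integral of \<open>b\<close> over \<open>[s, t]\<close> is at most
  \<open>K s - K t\<close>, which tends to zero because \<open>K\<close> converges.  The same monotone quantities show that
  \<open>G\<close> and \<open>H\<close> converge; hence \<open>b W\<close> converges, to zero because it is integrable, so that \<open>u\<close>
  vanishes in the limit and \<open>\<parallel>y - z\<parallel>\<close> converges.  Opial's lemma then yields the weak limit.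
\<close>

section \<open>Riesz representation and gradients\<close>

text \<open>The representing vector is found as the minimizer of the quadratic functional
  \<open>J\<close>: minimizing sequences are Cauchy by the parallelogram law, and stationarity at
  the limit is the required identity.\<close>

lemma riesz_representation:
  fixes \<phi> :: "'h::{real_inner, complete_space} \<Rightarrow> real"
  assumes "bounded_linear \<phi>"
  shows "\<exists>x. \<forall>v. \<phi> v = x \<bullet> v"
proof -
  interpret bounded_linear \<phi> by fact
  define J where "J x = (x \<bullet> x) / 2 - \<phi> x" for x
  obtain C where C: "\<And>x. norm (\<phi> x) \<le> norm x * C"
    using bounded by blast
  have J_ge: "- (C\<^sup>2 / 2) \<le> J x" for x
  proof -
    have "0 \<le> (norm x - C)\<^sup>2" by simp
    moreover have "\<phi> x \<le> norm x * C" using C[of x] by simp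
    ultimately show ?thesis
      by (simp add: J_def power2_norm_eq_inner[symmetric] power2_eq_square algebra_simps)
  qed
  define d where "d = (INF x. J x)"
  have bdd: "bdd_below (range J)"
    using J_ge by (auto intro!: bdd_belowI2)
  have d_le: "d \<le> J x" for x
    unfolding d_def by (rule cINF_lower[OF bdd]) simp
  have "\<exists>x. J x < d + 1 / real (Suc n)" for n
    using cINF_less_iff[OF UNIV_not_empty bdd, of "d + 1 / real (Suc n)"]
    by (auto simp: d_def)
  then obtain X where X: "\<And>n. J (X n) < d + 1 / real (Suc n)"
    by metis
  have parallelogram: "(norm (x - y))\<^sup>2 = 4 * (J x + J y - 2 * J ((1/2) *\<^sub>R (x + y)))" for x y
    by (simp add: J_def power2_norm_eq_inner add scaleR inner_add_left inner_add_right
        inner_diff_left inner_diff_right inner_commute[of y x] field_simps)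
  have "Cauchy X"
  proof (rule metric_CauchyI)
    \<comment> \<open>The margin \<open>e\<^sup>2 / 8\<close> below becomes \<open>e\<^sup>2\<close>
      through \<open>parallelogram\<close>, since \<open>J\<close> at the midpoint is at least
      \<open>d\<close>.\<close>
    fix e :: real assume e: "0 < e"
    obtain N where N: "inverse (real (Suc N)) < e\<^sup>2 / 8"
      using reals_Archimedean[of "e\<^sup>2 / 8"] e by auto
    have near: "J (X k) < d + e\<^sup>2 / 8" if "k \<ge> N" for k
    proof -
      have "1 / real (Suc k) \<le> 1 / real (Suc N)"
        using that by (simp add: frac_le)
      then show ?thesis using X[of k] N by (simp add: inverse_eq_divide)
    qed
    have "dist (X k) (X l) < e" if "k \<ge> N" "l \<ge> N" for k l
    proof -
      have "(norm (X k - X l))\<^sup>2 < e\<^sup>2"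
        using parallelogram[of "X k" "X l"] near[OF that(1)] near[OF that(2)]
          d_le[of "(1/2) *\<^sub>R (X k + X l)"] by argo
      then show ?thesis
        using e by (simp add: dist_norm power2_less_imp_less)
    qed
    then show "\<exists>M. \<forall>m\<ge>M. \<forall>n\<ge>M. dist (X m) (X n) < e" by blast
  qed
  then obtain L where L: "X \<longlonglongrightarrow> L"
    using Cauchy_convergent convergent_def by blast
  have "(\<lambda>n. J (X n)) \<longlonglongrightarrow> J L"
    unfolding J_def by (intro tendsto_intros tendsto L) simp
  moreover have "(\<lambda>n. d + 1 / real (Suc n)) \<longlonglongrightarrow> d + 0"
    by (intro tendsto_intros LIMSEQ_Suc[OF lim_1_over_n])
  ultimately have JL: "J L \<le> d"
    using X by (intro LIMSEQ_le) (auto intro: less_imp_le)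
  have "\<phi> v = L \<bullet> v" for v
  proof (cases "v = 0")
    case True
    then show ?thesis by (simp add: zero)
  next
    case False
    define c where "c = L \<bullet> v - \<phi> v"
    define q where "q = v \<bullet> v"
    have q: "q > 0" using False by (simp add: q_def)
    have J_line: "J (L + r *\<^sub>R v) = J L + r * c + r\<^sup>2 * q / 2" for r
      by (simp add: J_def add scaleR inner_add_left inner_add_right inner_commute[of v L] c_def
          q_def[symmetric] power2_eq_square add_divide_distrib algebra_simps)
    \<comment> \<open>The step \<open>- c / q\<close> minimizes the quadratic \<open>J_line\<close>;
      it would lower \<open>J\<close> by \<open>c\<^sup>2 / q / 2\<close>, so minimality of
      \<open>L\<close> forces \<open>c = 0\<close>.\<close>
    have "J L \<le> J (L + (- c / q) *\<^sub>R v)"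
      using JL d_le order_trans by blast
    also have "\<dots> = J L - c\<^sup>2 / q / 2"
      unfolding J_line using q by (simp add: power2_eq_square field_simps)
    finally have "c\<^sup>2 / q \<le> 0"
      using q by (simp add: power2_eq_square field_simps)
    then show ?thesis using q by (simp add: c_def divide_le_0_iff)
  qed
  then show ?thesis by blast
qed

lemma gderiv_unique:
  assumes "GDERIV f x :> g" and "GDERIV f x :> h"
  shows "g = h"
proof -
  have "(\<lambda>v. v \<bullet> g) = (\<lambda>v. v \<bullet> h)"
    using assms has_derivative_unique unfolding gderiv_def by blast
  then have "(g - h) \<bullet> g = (g - h) \<bullet> h" by meson
  then show ?thesis by (metis eq_iff_diff_eq_0 inner_diff_right inner_eq_zero_iff)
qed

text \<open>Riesz gives existence and \<open>gderiv_unique\<close> uniqueness, so the definite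
  description in \<open>gradient\<close> denotes the actual gradient.\<close>

lemma gderiv_gradient:
  fixes f :: "'h::{real_inner, complete_space} \<Rightarrow> real"
  assumes "f differentiable (at x)"
  shows "GDERIV f x :> gradient f x"
proof -
  obtain D where D: "(f has_derivative D) (at x)"
    using assms by (auto simp: differentiable_def)
  then obtain g where "\<And>v. D v = g \<bullet> v"
    using riesz_representation has_derivative_bounded_linear by blast
  then have "D = (\<lambda>v. v \<bullet> g)" by (auto simp: inner_commute)
  with D have "GDERIV f x :> g" by (simp add: gderiv_def)
  then show ?thesis
    unfolding gradient_def by (rule theI) (rule gderiv_unique[OF _ \<open>GDERIV f x :> g\<close>])
qed

text \<open>Restricting \<open>f\<close> to the line from \<open>x\<close> to \<open>z\<close>
  reduces this to the one-dimensional tangent inequality at parameter 0, evaluated at 1.\<close>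

lemma convex_on_gderiv_above_tangent:
  assumes "convex_on UNIV f" and "GDERIV f x :> g"
  shows "f x + g \<bullet> (z - x) \<le> f z"
proof -
  have "convex_on UNIV (\<lambda>s::real. f (x + s *\<^sub>R (z - x)))"
  proof (rule convex_onI)
    fix t r s :: real
    assume t: "0 < t" "t < 1"
    have "x + ((1 - t) *\<^sub>R r + t *\<^sub>R s) *\<^sub>R (z - x)
        = (1 - t) *\<^sub>R (x + r *\<^sub>R (z - x)) + t *\<^sub>R (x + s *\<^sub>R (z - x))"
      by (simp add: algebra_simps)
    then show "f (x + ((1 - t) *\<^sub>R r + t *\<^sub>R s) *\<^sub>R (z - x))
        \<le> (1 - t) * f (x + r *\<^sub>R (z - x)) + t * f (x + s *\<^sub>R (z - x))"
      using convex_onD[OF assms(1), of t] t by simp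
  qed simp
  moreover have "((\<lambda>s. f (x + s *\<^sub>R (z - x))) has_real_derivative (z - x) \<bullet> g) (at 0)"
  proof -
    have "((\<lambda>s::real. x + s *\<^sub>R (z - x)) has_derivative (\<lambda>s. s *\<^sub>R (z - x))) (at 0)"
      by (auto intro!: derivative_eq_intros)
    then have "((\<lambda>s. f (x + s *\<^sub>R (z - x))) has_derivative (\<lambda>s. (s *\<^sub>R (z - x)) \<bullet> g)) (at 0)"
      by (rule has_derivative_compose) (use assms(2) in \<open>simp add: gderiv_def\<close>)
    then show ?thesis
      by (simp add: has_field_derivative_def mult_commute_abs)
  qed
  ultimately show ?thesis
    using convex_on_imp_above_tangent[of UNIV "\<lambda>s. f (x + s *\<^sub>R (z - x))" 0 1 "(z - x) \<bullet> g"]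
    by (simp add: inner_commute)
qed

section \<open>Weak cluster points and Opial's lemma\<close>

lemma weakly_tendsto_iff_inner:
  fixes y :: "'b \<Rightarrow> 'h::{real_inner, complete_space}"
  shows "weakly_tendsto y x F \<longleftrightarrow> (\<forall>v. ((\<lambda>t. v \<bullet> y t) \<longlongrightarrow> v \<bullet> x) F)"
proof (intro iffI allI)
  fix v assume "weakly_tendsto y x F"
  then show "((\<lambda>t. v \<bullet> y t) \<longlongrightarrow> v \<bullet> x) F"
    unfolding weakly_tendsto_def using bounded_linear_inner_right by blast
next
  assume *: "\<forall>v. ((\<lambda>t. v \<bullet> y t) \<longlongrightarrow> v \<bullet> x) F"
  show "weakly_tendsto y x F"
    unfolding weakly_tendsto_def
  proof (intro allI impI)
    fix \<phi> :: "'h \<Rightarrow> real" assume "bounded_linear \<phi>"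
    then obtain v where "\<forall>w. \<phi> w = v \<bullet> w" using riesz_representation by blast
    with * show "((\<lambda>t. \<phi> (y t)) \<longlongrightarrow> \<phi> x) F" by simp
  qed
qed

text \<open>
  Filters replace subsequences here: \<open>y t\<close> is identified with the functional \<open>v \<mapsto> v \<bullet> y t\<close>, which
  ranges over a product of compact intervals, so Tychonoff's theorem provides a cluster point
  without any separability or diagonal argument.
\<close>

lemma weak_cluster_point:
  fixes y :: "'b \<Rightarrow> 'h::{real_inner, complete_space}"
  assumes "F \<noteq> bot" and bnd: "\<forall>\<^sub>F t in F. norm (y t) \<le> M"
  obtains F' x where "F' \<le> F" "F' \<noteq> bot" "weakly_tendsto y x F'"
proof -
  define e where "e = (\<lambda>t v. v \<bullet> y t)"
  define K where "K = (\<Pi>\<^sub>E v\<in>(UNIV::'h set). cball (0::real) (norm v * M))"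
  have "compactin (product_topology (\<lambda>v::'h. euclidean) UNIV) K"
    unfolding K_def compactin_PiE by simp
  then have "compact K" by (simp add: euclidean_product_topology)
  moreover have "filtermap e F \<noteq> bot"
    using assms(1) by (simp add: filtermap_bot_iff)
  moreover have "\<forall>\<^sub>F p in filtermap e F. p \<in> K"
    unfolding eventually_filtermap
  proof (rule eventually_mono[OF bnd])
    fix t assume "norm (y t) \<le> M"
    then have "\<bar>v \<bullet> y t\<bar> \<le> norm v * M" for v
      by (meson Cauchy_Schwarz_ineq2 mult_left_mono norm_ge_zero order_trans)
    then show "e t \<in> K" by (simp add: K_def e_def PiE_iff)
  qed
  ultimately obtain p where pK: "p \<in> K" and p: "inf (nhds p) (filtermap e F) \<noteq> bot"
    unfolding compact_filter by blast
  \<comment> \<open>Refining \<open>F\<close> by the preimages of neighbourhoods of \<open>p\<close>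
    forces \<open>e\<close> to converge to \<open>p\<close>; the refinement is proper because
    \<open>p\<close> is a cluster point of the image filter.\<close>
  define F' where "F' = inf F (filtercomap e (nhds p))"
  have "F' \<noteq> bot"
  proof
    assume "F' = bot"
    then obtain P Q where PQ: "eventually P F" "eventually Q (nhds p)" "\<And>t. P t \<Longrightarrow> \<not> Q (e t)"
      unfolding F'_def trivial_limit_def eventually_inf eventually_filtercomap by blast
    then have "eventually (\<lambda>q. \<not> Q q) (filtermap e F)"
      by (auto simp: eventually_filtermap elim: eventually_mono)
    with PQ(2) p show False
      unfolding trivial_limit_def eventually_inf by blast
  qed
  have "F' \<le> F" by (simp add: F'_def)
  have "filterlim e (nhds p) F'"
    unfolding F'_def by (rule filterlim_mono[OF filterlim_filtercomap]) auto
  then have lim: "((\<lambda>t. v \<bullet> y t) \<longlongrightarrow> p v) F'" for v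
    using continuous_on_tendsto_compose[OF continuous_on_product_coordinates[of v], of e p F']
    by (simp add: e_def)
  \<comment> \<open>Linearity passes to pointwise limits and membership in \<open>K\<close> bounds
    \<open>p\<close>, so Riesz turns this functional into the weak limit.\<close>
  have "bounded_linear p"
  proof (rule bounded_linear_intro[where K = M])
    show "p (v + w) = p v + p w" for v w
      using tendsto_unique[OF \<open>F' \<noteq> bot\<close> lim] tendsto_add[OF lim lim]
      by (simp add: inner_add_left)
    show "p (r *\<^sub>R v) = r *\<^sub>R p v" for r v
      using tendsto_unique[OF \<open>F' \<noteq> bot\<close> lim] tendsto_mult_left[OF lim]
      by simp
    show "norm (p v) \<le> norm v * M" for v
      using pK by (simp add: K_def PiE_iff)
  qed
  then obtain x where "\<And>v. p v = x \<bullet> v"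
    using riesz_representation by blast
  then have "weakly_tendsto y x F'"
    using lim by (simp add: weakly_tendsto_iff_inner inner_commute)
  with that \<open>F' \<le> F\<close> \<open>F' \<noteq> bot\<close> show thesis by blast
qed

text \<open>For weak cluster points \<open>x1\<close> and \<open>x2\<close>, both in
  \<open>S\<close>, the difference of the squared distances determines
  \<open>(x1 - x2) \<bullet> y t\<close>, which therefore converges along all of \<open>F\<close>.
  Comparing its limits along the two subfilters gives \<open>x1 = x2\<close>. Boundedness then turns
  the unique cluster point into the weak limit.\<close>

lemma opial:
  fixes y :: "'b \<Rightarrow> 'h::{real_inner, complete_space}"
  assumes "F \<noteq> bot" and "S \<noteq> {}"
    and dist: "\<And>z. z \<in> S \<Longrightarrow> \<exists>l. ((\<lambda>t. norm (y t - z)) \<longlongrightarrow> l) F"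
    and cluster: "\<And>F' x. F' \<le> F \<Longrightarrow> F' \<noteq> bot \<Longrightarrow> weakly_tendsto y x F' \<Longrightarrow> x \<in> S"
  shows "\<exists>x\<in>S. weakly_tendsto y x F"
proof -
  obtain z where "z \<in> S" using assms(2) by blast
  then obtain l where "((\<lambda>t. norm (y t - z)) \<longlongrightarrow> l) F" using dist by blast
  then have "\<forall>\<^sub>F t in F. norm (y t - z) < l + 1"
    by (rule order_tendstoD) simp
  then have bnd: "\<forall>\<^sub>F t in F. norm (y t) \<le> l + 1 + norm z"
    by (rule eventually_mono) (smt (verit) norm_triangle_sub)
  have unique: "x1 = x2"
    if 1: "F1 \<le> F" "F1 \<noteq> bot" "weakly_tendsto y x1 F1"
    and 2: "F2 \<le> F" "F2 \<noteq> bot" "weakly_tendsto y x2 F2" for x1 x2 F1 F2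
  proof -
    obtain l1 l2 where "((\<lambda>t. norm (y t - x1)) \<longlongrightarrow> l1) F" "((\<lambda>t. norm (y t - x2)) \<longlongrightarrow> l2) F"
      using dist cluster[OF 1] cluster[OF 2] by blast
    then have "((\<lambda>t. ((norm (y t - x2))\<^sup>2 - (norm (y t - x1))\<^sup>2 + x1 \<bullet> x1 - x2 \<bullet> x2) / 2)
        \<longlongrightarrow> (l2\<^sup>2 - l1\<^sup>2 + x1 \<bullet> x1 - x2 \<bullet> x2) / 2) F"
      by (intro tendsto_intros) auto
    moreover have "((norm (y t - x2))\<^sup>2 - (norm (y t - x1))\<^sup>2 + x1 \<bullet> x1 - x2 \<bullet> x2) / 2
        = (x1 - x2) \<bullet> y t" for t
      by (simp add: power2_norm_eq_inner inner_diff_left inner_diff_right inner_commute[of "y t" x1]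
          inner_commute[of "y t" x2])
    ultimately have lim: "((\<lambda>t. (x1 - x2) \<bullet> y t) \<longlongrightarrow> (l2\<^sup>2 - l1\<^sup>2 + x1 \<bullet> x1 - x2 \<bullet> x2) / 2) F"
      by simp
    have "(x1 - x2) \<bullet> x1 = (x1 - x2) \<bullet> x2"
      using tendsto_unique[OF 1(2) tendsto_mono[OF 1(1) lim]]
        tendsto_unique[OF 2(2) tendsto_mono[OF 2(1) lim]] 1(3) 2(3)
      unfolding weakly_tendsto_iff_inner by metis
    then show "x1 = x2"
      by (metis eq_iff_diff_eq_0 inner_diff_right inner_eq_zero_iff)
  qed
  obtain F1 x where 1: "F1 \<le> F" "F1 \<noteq> bot" "weakly_tendsto y x F1"
    using weak_cluster_point[OF assms(1) bnd] .
  have "weakly_tendsto y x F"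
    unfolding weakly_tendsto_iff_inner
  proof (intro allI, rule ccontr)
    fix v assume "\<not> ((\<lambda>t. v \<bullet> y t) \<longlongrightarrow> v \<bullet> x) F"
    then obtain \<epsilon> where \<epsilon>: "\<epsilon> > 0" "\<not> (\<forall>\<^sub>F t in F. dist (v \<bullet> y t) (v \<bullet> x) < \<epsilon>)"
      unfolding tendsto_iff by blast
    \<comment> \<open>On \<open>F0\<close> the value \<open>v \<bullet> y t\<close> stays away from
      \<open>v \<bullet> x\<close>, yet any weak cluster point along \<open>F0\<close> must be
      \<open>x\<close> by uniqueness.\<close>
    define F0 where "F0 = inf F (principal {t. \<not> dist (v \<bullet> y t) (v \<bullet> x) < \<epsilon>})"
    have F0: "F0 \<le> F" "F0 \<noteq> bot"
      using \<epsilon>(2) by (simp_all add: F0_def trivial_limit_def eventually_inf_principal)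
    obtain F2 x2 where 2: "F2 \<le> F0" "F2 \<noteq> bot" "weakly_tendsto y x2 F2"
      using weak_cluster_point[OF F0(2) filter_leD[OF F0(1) bnd]] .
    have "x2 = x"
      using unique[of F2 x2 F1 x] 1 2 F0(1) order_trans by blast
    then have "\<forall>\<^sub>F t in F2. dist (v \<bullet> y t) (v \<bullet> x) < \<epsilon>"
      using 2(3) \<epsilon>(1) unfolding weakly_tendsto_iff_inner by (auto intro: tendstoD)
    moreover have "\<forall>\<^sub>F t in F2. \<not> dist (v \<bullet> y t) (v \<bullet> x) < \<epsilon>"
      by (rule filter_leD[OF 2(1)]) (simp add: F0_def eventually_inf_principal)
    ultimately have "\<forall>\<^sub>F t in F2. False" by eventually_elim simp
    with 2(2) show False by (simp add: trivial_limit_def)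
  qed
  then show ?thesis using cluster[OF 1] by blast
qed

section \<open>Lyapunov functions along a trajectory\<close>

lemma deriv_nonpos_bounded_below_convergent:
  fixes X :: "real \<Rightarrow> real"
  assumes deriv: "\<And>t. t > a \<Longrightarrow> (X has_real_derivative X' t) (at t)"
    and nonpos: "\<And>t. t > a \<Longrightarrow> X' t \<le> 0"
    and lower: "\<And>t. t > a \<Longrightarrow> c \<le> X t"
  shows "\<exists>l. (X \<longlongrightarrow> l) at_top"
proof -
  have anti: "X t \<le> X s" if "a < s" "s \<le> t" for s t
  proof (rule DERIV_nonpos_imp_nonincreasing[OF that(2)], intro exI conjI)
    fix r assume "s \<le> r"
    then have "a < r" using that(1) by simp
    then show "(X has_real_derivative X' r) (at r)" and "X' r \<le> 0"
      by (rule deriv, rule nonpos)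
  qed
  define l where "l = (INF t\<in>{a<..}. X t)"
  have bdd: "bdd_below (X ` {a<..})"
    using lower by (auto intro!: bdd_belowI2)
  have "(X \<longlongrightarrow> l) at_top"
  proof (rule decreasing_tendsto)
    show "\<forall>\<^sub>F t in at_top. l \<le> X t"
      using eventually_gt_at_top[of a]
      by eventually_elim (auto simp: l_def intro: cINF_lower[OF bdd])
    fix x assume "l < x"
    then obtain s where s: "s > a" "X s < x"
      using cINF_less_iff[OF _ bdd, of x] by (auto simp: l_def)
    show "\<forall>\<^sub>F t in at_top. X t < x"
      using eventually_ge_at_top[of s] by eventually_elim (use anti s in force)
  qed
  then show ?thesis by blast
qed

text \<open>The equation appears as a first-order system in \<open>y\<close> and the velocity
  \<open>u\<close>, at times \<open>t > t0\<close>, where derivatives are two-sided. The bound on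
  \<open>b' / b\<close> is kept as \<open>b' \<le> m * b\<close>, free of division. The minimizer
  \<open>z\<close> is a parameter because Opial's lemma needs every minimizer.\<close>

locale damped_gradient_trajectory =
  fixes f :: "'h::real_inner \<Rightarrow> real" and g :: "'h \<Rightarrow> 'h"
    and b b' :: "real \<Rightarrow> real" and y u :: "real \<Rightarrow> 'h" and t0 lam m :: real and z :: 'h
  assumes convex: "convex_on UNIV f"
    and gderiv_f: "\<And>x. GDERIV f x :> g x"
    and minimal: "\<And>x. f z \<le> f x"
    and m_pos: "0 < m" and m_less: "m < lam"
    and b_pos: "\<And>t. t > t0 \<Longrightarrow> b t > 0"
    and b_deriv: "\<And>t. t > t0 \<Longrightarrow> (b has_real_derivative b' t) (at t)"
    and b'_nonneg: "\<And>t. t > t0 \<Longrightarrow> 0 \<le> b' t"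
    and b'_le: "\<And>t. t > t0 \<Longrightarrow> b' t \<le> m * b t"
    and y_deriv: "\<And>t. t > t0 \<Longrightarrow> (y has_vector_derivative u t) (at t)"
    and u_deriv: "\<And>t. t > t0 \<Longrightarrow>
      (u has_vector_derivative - (lam *\<^sub>R u t) - b t *\<^sub>R g (y t)) (at t)"
begin

definition gap :: "real \<Rightarrow> real" where
  "gap t = f (y t) - f z"

definition W :: "real \<Rightarrow> real" where
  "W t = gap t + 1 / (2 * b t) * (norm (u t))\<^sup>2"

text \<open>With \<open>h\<close> half the squared distance to \<open>z\<close>, this is
  \<open>h' + lam * h\<close>; the weight \<open>lam / 2\<close> makes the damping term
  \<open>lam * (u t \<bullet> (y t - z))\<close> cancel in the derivative.\<close>

definition H :: "real \<Rightarrow> real" where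
  "H t = u t \<bullet> (y t - z) + lam / 2 * (norm (y t - z))\<^sup>2"

text \<open>
  Convexity gives \<open>H' \<le> \<parallel>u\<parallel>\<^sup>2 - b * gap\<close>.  In the derivative of \<open>b * W\<close> the only positive term is
  \<open>b' * gap \<le> m * b * gap\<close>, which the summand \<open>m * H\<close> of \<open>G\<close> absorbs; the weight in \<open>K\<close> is chosen so
  that \<open>K' \<le> - b * W\<close>.
\<close>

definition G :: "real \<Rightarrow> real" where
  "G t = b t * W t + m * H t"

definition K :: "real \<Rightarrow> real" where
  "K t = 3 / (2 * (lam - m)) * G t + H t"

lemma gap_nonneg: "0 \<le> gap t"
  using minimal by (simp add: gap_def)

lemma lam_pos: "0 < lam"
  using m_pos m_less by simp

lemma W_nonneg: "t > t0 \<Longrightarrow> 0 \<le> W t"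
  using gap_nonneg b_pos[of t] by (simp add: W_def)

lemma b_W: "t > t0 \<Longrightarrow> b t * W t = b t * gap t + (norm (u t))\<^sup>2 / 2"
  using b_pos[of t] by (simp add: W_def field_simps)

lemma gap_deriv:
  assumes "t > t0"
  shows "(gap has_real_derivative u t \<bullet> g (y t)) (at t)"
proof -
  have "((\<lambda>s. f (y s)) has_derivative (\<lambda>h. (h *\<^sub>R u t) \<bullet> g (y t))) (at t)"
    using has_derivative_compose[OF y_deriv[OF assms, unfolded has_vector_derivative_def]]
      gderiv_f[of "y t"] unfolding gderiv_def by blast
  then have "((\<lambda>s. f (y s)) has_real_derivative u t \<bullet> g (y t)) (at t)"
    by (simp add: has_field_derivative_def mult_commute_abs)
  then show ?thesis
    unfolding gap_def by (auto intro!: derivative_eq_intros)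
qed

lemma norm2_u_deriv:
  assumes "t > t0"
  shows "((\<lambda>t. (norm (u t))\<^sup>2) has_real_derivative
    - 2 * lam * (norm (u t))\<^sup>2 - 2 * b t * (u t \<bullet> g (y t))) (at t)"
proof -
  note u = u_deriv[OF assms, unfolded has_vector_derivative_def]
  show ?thesis
    unfolding power2_norm_eq_inner has_field_derivative_def
    by (rule has_derivative_eq_rhs[OF has_derivative_inner[OF u u]])
      (simp add: fun_eq_iff inner_diff_left inner_diff_right inner_commute[of "g (y t)" "u t"]
        algebra_simps)
qed

lemma gap_le: "gap t \<le> g (y t) \<bullet> (y t - z)"
  using convex_on_gderiv_above_tangent[OF convex gderiv_f[of "y t"], of z]
  by (simp add: gap_def inner_diff_right)

definition H' :: "real \<Rightarrow> real" where
  "H' t = (norm (u t))\<^sup>2 - b t * (g (y t) \<bullet> (y t - z))"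

lemma H_deriv:
  assumes "t > t0"
  shows "(H has_real_derivative H' t) (at t)"
proof -
  note u = u_deriv[OF assms, unfolded has_vector_derivative_def]
  have w: "((\<lambda>t. y t - z) has_derivative (\<lambda>h. h *\<^sub>R u t)) (at t)"
    using y_deriv[OF assms, unfolded has_vector_derivative_def]
    by (auto intro!: derivative_eq_intros)
  have 1: "((\<lambda>t. u t \<bullet> (y t - z)) has_real_derivative
      u t \<bullet> u t - lam * (u t \<bullet> (y t - z)) - b t * (g (y t) \<bullet> (y t - z))) (at t)"
    unfolding has_field_derivative_def
    by (rule has_derivative_eq_rhs[OF has_derivative_inner[OF u w]])
      (simp add: fun_eq_iff inner_diff_left algebra_simps)
  have 2: "((\<lambda>t. (norm (y t - z))\<^sup>2) has_real_derivative 2 * (u t \<bullet> (y t - z))) (at t)"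
    unfolding has_field_derivative_def power2_norm_eq_inner
    by (rule has_derivative_eq_rhs[OF has_derivative_inner[OF w w]])
      (simp add: fun_eq_iff inner_commute)
  have "((\<lambda>t. u t \<bullet> (y t - z) + lam / 2 * (norm (y t - z))\<^sup>2) has_real_derivative
      (u t \<bullet> u t - lam * (u t \<bullet> (y t - z)) - b t * (g (y t) \<bullet> (y t - z)))
      + lam / 2 * (2 * (u t \<bullet> (y t - z)))) (at t)"
    by (intro DERIV_add 1 DERIV_cmult 2)
  then show ?thesis
    unfolding H_def H'_def by (simp add: power2_norm_eq_inner)
qed

definition G' :: "real \<Rightarrow> real" where
  "G' t = b' t * gap t - lam * (norm (u t))\<^sup>2 + m * H' t"

definition K' :: "real \<Rightarrow> real" where
  "K' t = 3 / (2 * (lam - m)) * G' t + H' t"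

lemma H'_le: "t > t0 \<Longrightarrow> H' t \<le> (norm (u t))\<^sup>2 - b t * gap t"
  using mult_left_mono[OF gap_le, of "b t" t] b_pos[of t] by (simp add: H'_def)

lemma G_deriv:
  assumes "t > t0"
  shows "(G has_real_derivative G' t) (at t)"
proof -
  \<comment> \<open>By \<open>b_W\<close> this function agrees with \<open>G\<close> after
    \<open>t0\<close>; the contributions \<open>b t * (u t \<bullet> g (y t))\<close> of potential
    and kinetic energy cancel.\<close>
  have "((\<lambda>t. b t * gap t + (norm (u t))\<^sup>2 / 2 + m * H t) has_real_derivative
      b' t * gap t + u t \<bullet> g (y t) * b t
      + (- 2 * lam * (norm (u t))\<^sup>2 - 2 * b t * (u t \<bullet> g (y t))) / 2 + m * H' t) (at t)"
    by (intro DERIV_add DERIV_cmult DERIV_cdivide DERIV_mult b_deriv gap_deriv norm2_u_deriv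
        H_deriv assms)
  then have "((\<lambda>t. b t * gap t + (norm (u t))\<^sup>2 / 2 + m * H t) has_real_derivative G' t) (at t)"
    by (rule DERIV_cong) (simp add: G'_def field_simps)
  then show ?thesis
    by (rule has_field_derivative_transform_within_open[where S = "{t0<..}"])
      (use assms b_W in \<open>auto simp: G_def\<close>)
qed

lemma G'_le:
  assumes "t > t0"
  shows "G' t \<le> - ((lam - m) * (norm (u t))\<^sup>2)"
proof -
  have "b' t * gap t \<le> m * b t * gap t"
    using mult_right_mono[OF b'_le[OF assms] gap_nonneg] .
  moreover have "m * H' t \<le> m * ((norm (u t))\<^sup>2 - b t * gap t)"
    using mult_left_mono[OF H'_le[OF assms]] m_pos by simp
  ultimately show ?thesis by (simp add: G'_def algebra_simps)
qed

lemma G'_nonpos: "t > t0 \<Longrightarrow> G' t \<le> 0"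
  using G'_le[of t] m_less by (smt (verit) mult_nonneg_nonneg zero_le_power2)

lemma K_deriv: "t > t0 \<Longrightarrow> (K has_real_derivative K' t) (at t)"
  unfolding K_def K'_def by (intro DERIV_add DERIV_cmult G_deriv H_deriv)

lemma K'_le:
  assumes "t > t0"
  shows "K' t \<le> - (b t * W t)"
proof -
  \<comment> \<open>Of the \<open>- 3/2\<close> squared speeds obtained here, one absorbs the
    positive term of \<open>H'\<close>; the remaining half is the kinetic part of
    \<open>b * W\<close>.\<close>
  have "3 / (2 * (lam - m)) * G' t \<le> 3 / (2 * (lam - m)) * (- ((lam - m) * (norm (u t))\<^sup>2))"
    using m_less by (intro mult_left_mono G'_le assms) auto
  also have "\<dots> = - (3 / 2 * (norm (u t))\<^sup>2)"
    using m_less by (simp add: field_simps)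
  finally show ?thesis
    using H'_le[OF assms] b_W[OF assms] by (simp add: K'_def)
qed

text \<open>Complete the square in \<open>y t - z\<close>.\<close>

lemma H_ge: "- ((norm (u t))\<^sup>2 / (2 * lam)) \<le> H t"
proof -
  have "0 \<le> (norm (u t + lam *\<^sub>R (y t - z)))\<^sup>2 / (2 * lam)"
    using lam_pos by simp
  also have "\<dots> = (norm (u t))\<^sup>2 / (2 * lam) + H t"
    unfolding H_def power2_norm_eq_inner inner_add_left inner_add_right
      inner_scaleR_left inner_scaleR_right
    using lam_pos by (simp add: inner_commute[of "y t - z" "u t"] field_simps)
  finally show ?thesis by simp
qed

text \<open>Since \<open>m < lam\<close>, the kinetic half in \<open>b * W\<close> outweighs the
  loss \<open>m / (2 * lam)\<close> that \<open>H_ge\<close> allows.\<close>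

lemma G_ge_norm_u:
  assumes "t > t0"
  shows "(lam - m) / (2 * lam) * (norm (u t))\<^sup>2 \<le> G t"
proof -
  have "m * (- ((norm (u t))\<^sup>2 / (2 * lam))) \<le> m * H t"
    using m_pos by (intro mult_left_mono H_ge) auto
  moreover have "(lam - m) / (2 * lam) * (norm (u t))\<^sup>2
      = (norm (u t))\<^sup>2 / 2 + m * (- ((norm (u t))\<^sup>2 / (2 * lam)))"
    using lam_pos by (simp add: field_simps)
  moreover have "0 \<le> b t * gap t"
    using b_pos[OF assms] gap_nonneg by simp
  ultimately show ?thesis by (simp add: G_def b_W[OF assms])
qed

text \<open>Completing the square with weight \<open>m\<close> in place of \<open>lam\<close> leaves
  a positive multiple of the squared distance, which later bounds the trajectory.\<close>

lemma G_ge_dist: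
  assumes "t > t0"
  shows "m * (lam - m) / 2 * (norm (y t - z))\<^sup>2 \<le> G t"
proof -
  have "0 \<le> (norm (u t + m *\<^sub>R (y t - z)))\<^sup>2 / 2 + b t * gap t"
    using b_pos[OF assms] gap_nonneg by simp
  also have "\<dots> = G t - m * (lam - m) / 2 * (norm (y t - z))\<^sup>2"
    unfolding G_def b_W[OF assms] H_def power2_norm_eq_inner inner_add_left inner_add_right
      inner_scaleR_left inner_scaleR_right
    by (simp add: inner_commute[of "y t - z" "u t"] field_simps)
  finally show ?thesis by simp
qed

lemma G_nonneg: "t > t0 \<Longrightarrow> 0 \<le> G t"
  using G_ge_norm_u[of t] m_less lam_pos by (smt (verit) divide_nonneg_pos mult_nonneg_nonneg zero_le_power2)

text \<open>The factor \<open>1 / (lam - m)\<close> scales the bound of \<open>G_ge_norm_u\<close>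
  to exactly the deficit in \<open>H_ge\<close>.\<close>

lemma G_H_nonneg:
  assumes "t > t0"
  shows "0 \<le> 1 / (lam - m) * G t + H t"
proof -
  have "(norm (u t))\<^sup>2 / (2 * lam) = 1 / (lam - m) * ((lam - m) / (2 * lam) * (norm (u t))\<^sup>2)"
    using m_less by simp
  also have "\<dots> \<le> 1 / (lam - m) * G t"
    using m_less by (intro mult_left_mono G_ge_norm_u assms) auto
  finally show ?thesis using H_ge[of t] by simp
qed

lemma K_nonneg:
  assumes "t > t0"
  shows "0 \<le> K t"
proof -
  have "1 / (lam - m) * G t \<le> 3 / (2 * (lam - m)) * G t"
    using m_less G_nonneg[OF assms] by (intro mult_right_mono) (auto simp: field_simps)
  then show ?thesis using G_H_nonneg[OF assms] by (simp add: K_def)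
qed

section \<open>Decay rates from the integral of \<open>b\<close>\<close>

text \<open>Dividing the kinetic energy by \<open>b\<close> makes the gradient terms cancel in the
  derivative; friction and the growth of \<open>b\<close> leave only nonpositive terms.\<close>

lemma W_antimono:
  assumes "t0 < s" and "s \<le> t"
  shows "W t \<le> W s"
proof (rule DERIV_nonpos_imp_nonincreasing[OF assms(2)])
  fix r assume "s \<le> r" "r \<le> t"
  then have r: "r > t0" using assms by simp
  have "(W has_real_derivative - (lam / b r + b' r / (2 * (b r)\<^sup>2)) * (norm (u r))\<^sup>2) (at r)"
  proof -
    have "((\<lambda>t. gap t + (norm (u t))\<^sup>2 / (2 * b t)) has_real_derivative
        u r \<bullet> g (y r) + ((- 2 * lam * (norm (u r))\<^sup>2 - 2 * b r * (u r \<bullet> g (y r))) * (2 * b r)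
          - (norm (u r))\<^sup>2 * (2 * b' r)) / ((2 * b r) * (2 * b r))) (at r)"
      using b_pos[OF r]
      by (intro DERIV_add DERIV_divide DERIV_cmult b_deriv gap_deriv norm2_u_deriv r) simp
    then have "((\<lambda>t. gap t + (norm (u t))\<^sup>2 / (2 * b t)) has_real_derivative
        - (lam / b r + b' r / (2 * (b r)\<^sup>2)) * (norm (u r))\<^sup>2) (at r)"
      by (rule DERIV_cong) (use b_pos[OF r] in \<open>simp add: power2_eq_square field_simps\<close>)
    moreover have "W = (\<lambda>t. gap t + (norm (u t))\<^sup>2 / (2 * b t))"
      by (simp add: fun_eq_iff W_def)
    ultimately show ?thesis by simp
  qed
  moreover have "- (lam / b r + b' r / (2 * (b r)\<^sup>2)) * (norm (u r))\<^sup>2 \<le> 0"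
  proof (rule mult_nonpos_nonneg)
    have "0 \<le> lam / b r + b' r / (2 * (b r)\<^sup>2)"
      using b_pos[OF r] b'_nonneg[OF r] lam_pos by simp
    then show "- (lam / b r + b' r / (2 * (b r)\<^sup>2)) \<le> 0" by linarith
  qed simp
  ultimately show "\<exists>d. (W has_real_derivative d) (at r) \<and> d \<le> 0" by blast
qed

lemma b_integrable:
  assumes "t0 < s"
  shows "b integrable_on {s..t}"
proof -
  have "continuous_on {s..t} b"
    by (rule DERIV_continuous_on[where D = b']) (use assms in \<open>auto intro: DERIV_subset[OF b_deriv]\<close>)
  then show ?thesis by (rule integrable_continuous_real)
qed

lemma b_mono:
  assumes "t0 < s" and "s \<le> t"
  shows "b s \<le> b t"
proof (rule DERIV_nonneg_imp_nondecreasing[OF assms(2)])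
  fix r assume "s \<le> r"
  then show "\<exists>d. (b has_real_derivative d) (at r) \<and> 0 \<le> d"
    using assms(1) b_deriv[of r] b'_nonneg[of r] by auto
qed

lemma b_integral_pos:
  assumes "t0 < s" and "s < t"
  shows "0 < integral {s..t} b"
proof -
  have "0 < (t - s) * b s"
    using assms b_pos by simp
  also have "\<dots> = integral {s..t} (\<lambda>_. b s)"
    using assms by simp
  also have "\<dots> \<le> integral {s..t} b"
    using assms by (intro integral_le b_integrable integrable_const_ivl b_mono) auto
  finally show ?thesis .
qed

lemma W_integral_le:
  assumes "t0 < s" and "s \<le> t"
  shows "W t * integral {s..t} b \<le> K s - K t"
proof -
  have "((\<lambda>r. W t * b r) has_integral W t * integral {s..t} b) {s..t}"
    by (intro has_integral_mult_right integrable_integral b_integrable assms)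
  moreover have "((\<lambda>r. - K' r) has_integral - (K t - K s)) {s..t}"
    using assms
    by (intro has_integral_neg fundamental_theorem_of_calculus)
      (auto simp: has_real_derivative_iff_has_vector_derivative[symmetric]
        intro: DERIV_subset[OF K_deriv])
  moreover have "W t * b r \<le> - K' r" if "r \<in> {s..t}" for r
  proof -
    have "b r * W t \<le> b r * W r"
      using that assms b_pos[of r] by (intro mult_left_mono W_antimono) auto
    then show ?thesis using K'_le[of r] that assms by (simp add: mult.commute)
  qed
  ultimately have "W t * integral {s..t} b \<le> - (K t - K s)" by (rule has_integral_le)
  then show ?thesis by simp
qed

lemma K_convergent: "\<exists>l. (K \<longlongrightarrow> l) at_top"
  using deriv_nonpos_bounded_below_convergent[of t0 K K' 0] K_deriv K_nonneg
    K'_le b_pos W_nonneg by (smt (verit) mult_nonneg_nonneg)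

lemma W_integral_tendsto_0:
  "((\<lambda>t. W t * integral {(t + t0) / 2..t} b) \<longlongrightarrow> 0) at_top"
proof -
  obtain l where l: "(K \<longlongrightarrow> l) at_top" using K_convergent by blast
  \<comment> \<open>Both endpoints of the integration interval go to infinity, so the two values of
    \<open>K\<close> have the same limit.\<close>
  have "filterlim (\<lambda>t. (t + t0) / 2) at_top at_top" by real_asymp
  from filterlim_compose[OF l this] l
  have lim: "((\<lambda>t. K ((t + t0) / 2) - K t) \<longlongrightarrow> l - l) at_top"
    by (rule tendsto_diff)
  show ?thesis
  proof (rule tendsto_sandwich[OF _ _ tendsto_const])
    show "((\<lambda>t. K ((t + t0) / 2) - K t) \<longlongrightarrow> 0) at_top" using lim by simp
    show "\<forall>\<^sub>F t in at_top. 0 \<le> W t * integral {(t + t0) / 2..t} b"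
      using eventually_gt_at_top[of t0]
    proof eventually_elim
      case (elim t)
      then have "0 < integral {(t + t0) / 2..t} b"
        by (intro b_integral_pos) auto
      with elim W_nonneg show ?case by simp
    qed
    show "\<forall>\<^sub>F t in at_top. W t * integral {(t + t0) / 2..t} b \<le> K ((t + t0) / 2) - K t"
      using eventually_gt_at_top[of t0] by eventually_elim (auto intro!: W_integral_le)
  qed
qed

lemma W_smallo: "W \<in> o(\<lambda>t. 1 / integral {(t + t0) / 2..t} b)"
proof (rule smalloI_tendsto)
  show "((\<lambda>t. W t / (1 / integral {(t + t0) / 2..t} b)) \<longlongrightarrow> 0) at_top"
    using W_integral_tendsto_0 by simp
  show "\<forall>\<^sub>F t in at_top. 1 / integral {(t + t0) / 2..t} b \<noteq> 0"
    using eventually_gt_at_top[of t0]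
  proof eventually_elim
    case (elim t)
    then show ?case using b_integral_pos[of "(t + t0) / 2" t] by simp
  qed
qed

lemma gap_smallo: "gap \<in> o(\<lambda>t. 1 / integral {(t + t0) / 2..t} b)"
proof -
  have "gap \<in> O(W)"
  proof (rule bigoI[where c = 1])
    show "\<forall>\<^sub>F t in at_top. norm (gap t) \<le> 1 * norm (W t)"
      using eventually_gt_at_top[of t0]
      by eventually_elim
        (use b_pos gap_nonneg in \<open>simp add: W_def less_imp_le\<close>)
  qed
  then show ?thesis using W_smallo by (rule landau_o.big_small_trans)
qed

text \<open>The kinetic part of \<open>W\<close> gives
  \<open>(norm (u t))\<^sup>2 / b t \<le> 2 * W t\<close>; the rate is the square root of the one
  for \<open>W\<close>.\<close>

lemma norm_u_smallo:
  "(\<lambda>t. norm (u t)) \<in> o(\<lambda>t. sqrt (b t / integral {(t + t0) / 2..t} b))"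
proof (rule smalloI_tendsto)
  let ?I = "\<lambda>t. integral {(t + t0) / 2..t} b"
  have pos: "0 < b t" "0 < ?I t" if "t > t0" for t
    using that b_pos b_integral_pos[of "(t + t0) / 2" t] by auto
  show "((\<lambda>t. norm (u t) / sqrt (b t / ?I t)) \<longlongrightarrow> 0) at_top"
  proof (rule tendsto_sandwich[OF _ _ tendsto_const])
    show "((\<lambda>t. sqrt (2 * (W t * ?I t))) \<longlongrightarrow> 0) at_top"
      using tendsto_real_sqrt[OF tendsto_mult_left[OF W_integral_tendsto_0, of 2]] by simp
    show "\<forall>\<^sub>F t in at_top. 0 \<le> norm (u t) / sqrt (b t / ?I t)"
      using eventually_gt_at_top[of t0]
      by eventually_elim (use pos in \<open>simp add: less_imp_le\<close>)
    show "\<forall>\<^sub>F t in at_top. norm (u t) / sqrt (b t / ?I t) \<le> sqrt (2 * (W t * ?I t))"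
      using eventually_gt_at_top[of t0]
    proof eventually_elim
      case (elim t)
      have "norm (u t) / sqrt (b t / ?I t) = sqrt ((norm (u t))\<^sup>2 / (b t / ?I t))"
        by (simp only: real_sqrt_divide real_sqrt_abs abs_norm_cancel)
      also have "\<dots> = sqrt (((norm (u t))\<^sup>2 / b t) * ?I t)" by simp
      also have "\<dots> \<le> sqrt ((2 * W t) * ?I t)"
        using pos[OF elim] gap_nonneg[of t]
        by (intro real_sqrt_le_mono mult_right_mono) (simp_all add: W_def)
      finally show ?case by (simp add: mult.assoc)
    qed
  qed
  show "\<forall>\<^sub>F t in at_top. sqrt (b t / ?I t) \<noteq> 0"
    using eventually_gt_at_top[of t0] by eventually_elim (use pos in force)
qed

section \<open>Limits at infinity and minimality of weak cluster points\<close>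

lemma G_convergent: "\<exists>l. (G \<longlongrightarrow> l) at_top"
  by (rule deriv_nonpos_bounded_below_convergent[OF G_deriv G'_nonpos G_nonneg])

text \<open>The derivative of \<open>H\<close> may be positive through the squared speed; adding
  \<open>G / (lam - m)\<close> cancels that term, and the limit of \<open>G\<close> is subtracted
  afterwards.\<close>

lemma H_convergent: "\<exists>l. (H \<longlongrightarrow> l) at_top"
proof -
  have "\<exists>l. ((\<lambda>t. 1 / (lam - m) * G t + H t) \<longlongrightarrow> l) at_top"
  proof (rule deriv_nonpos_bounded_below_convergent)
    fix t assume t: "t > t0"
    show "((\<lambda>t. 1 / (lam - m) * G t + H t) has_real_derivative 1 / (lam - m) * G' t + H' t) (at t)"
      by (intro DERIV_add DERIV_cmult G_deriv H_deriv t)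
    have "1 / (lam - m) * G' t \<le> 1 / (lam - m) * (- ((lam - m) * (norm (u t))\<^sup>2))"
      using m_less by (intro mult_left_mono G'_le t) auto
    also have "\<dots> = - (norm (u t))\<^sup>2" using m_less by simp
    finally show "1 / (lam - m) * G' t + H' t \<le> 0"
      using H'_le[OF t] mult_nonneg_nonneg[OF less_imp_le[OF b_pos[OF t]] gap_nonneg[of t]]
      by linarith
    show "0 \<le> 1 / (lam - m) * G t + H t" by (rule G_H_nonneg[OF t])
  qed
  then obtain k where k: "((\<lambda>t. 1 / (lam - m) * G t + H t) \<longlongrightarrow> k) at_top" by blast
  obtain l where l: "(G \<longlongrightarrow> l) at_top" using G_convergent by blast
  have "((\<lambda>t. (1 / (lam - m) * G t + H t) - 1 / (lam - m) * G t) \<longlongrightarrow> k - 1 / (lam - m) * l) at_top"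
    by (intro tendsto_diff k tendsto_mult_left l)
  then show ?thesis by auto
qed

lemma b_W_tendsto_0: "((\<lambda>t. b t * W t) \<longlongrightarrow> 0) at_top"
proof -
  obtain k l where "(G \<longlongrightarrow> k) at_top" "(H \<longlongrightarrow> l) at_top"
    using G_convergent H_convergent by blast
  then have "((\<lambda>t. G t - m * H t) \<longlongrightarrow> k - m * l) at_top"
    by (intro tendsto_intros)
  then have lim: "((\<lambda>t. b t * W t) \<longlongrightarrow> k - m * l) at_top"
    by (simp add: G_def)
  define p where "p = k - m * l"
  have "0 \<le> p"
    unfolding p_def
  proof (rule tendsto_lowerbound[OF lim])
    show "\<forall>\<^sub>F t in at_top. 0 \<le> b t * W t"
      using eventually_gt_at_top[of t0]
      by eventually_elim (use b_pos W_nonneg in \<open>simp add: less_imp_le\<close>)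
  qed simp
  moreover have False if "0 < p"
  proof -
    have "\<forall>\<^sub>F t in at_top. p / 2 < b t * W t"
      using order_tendstoD(1)[OF lim[folded p_def], of "p / 2"] that by simp
    then obtain T0 where T0: "\<And>t. t \<ge> T0 \<Longrightarrow> p / 2 < b t * W t"
      by (auto simp: eventually_at_top_linorder)
    define T where "T = max T0 (t0 + 1)"
    \<comment> \<open>At this time a decrease of \<open>K\<close> at rate at least
      \<open>p / 2\<close> from \<open>T\<close> on would give \<open>K t \<le> - 1\<close>.\<close>
    define t where "t = T + 2 * (K T + 1) / p"
    have T: "T > t0" by (simp add: T_def)
    have "T \<le> t" using K_nonneg[OF T] that by (simp add: t_def)
    have "K t + p / 2 * t \<le> K T + p / 2 * T"
    proof (rule DERIV_nonpos_imp_nonincreasing[OF \<open>T \<le> t\<close>], intro exI conjI)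
      fix r assume r: "T \<le> r"
      then show "((\<lambda>t. K t + p / 2 * t) has_real_derivative K' r + p / 2 * 1) (at r)"
        using T by (intro DERIV_add DERIV_cmult K_deriv DERIV_ident) simp
      show "K' r + p / 2 * 1 \<le> 0"
        using K'_le[of r] T0[of r] T r by (simp add: T_def)
    qed
    moreover have "p / 2 * t = p / 2 * T + (K T + 1)"
      using that by (simp add: t_def field_simps)
    ultimately show False using K_nonneg[of t] T \<open>T \<le> t\<close> by simp
  qed
  ultimately show ?thesis using lim unfolding p_def by fastforce
qed

lemma norm_u_tendsto_0: "((\<lambda>t. norm (u t)) \<longlongrightarrow> 0) at_top"
proof -
  have "((\<lambda>t. (norm (u t))\<^sup>2) \<longlongrightarrow> 0) at_top"
  proof (rule tendsto_sandwich[OF _ _ tendsto_const])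
    show "((\<lambda>t. 2 * (b t * W t)) \<longlongrightarrow> 0) at_top"
      using tendsto_mult_left[OF b_W_tendsto_0, of 2] by simp
    show "\<forall>\<^sub>F t in at_top. (norm (u t))\<^sup>2 \<le> 2 * (b t * W t)"
      using eventually_gt_at_top[of t0]
      by eventually_elim (use b_pos gap_nonneg in \<open>simp add: b_W less_imp_le\<close>)
  qed simp
  from tendsto_real_sqrt[OF this] show ?thesis by simp
qed

text \<open>The cross term of \<open>H\<close> vanishes in the limit, because \<open>u\<close> tends
  to zero and \<open>G_ge_dist\<close> keeps \<open>y - z\<close> bounded; what remains is a
  multiple of the squared distance.\<close>

lemma dist_convergent: "\<exists>l. ((\<lambda>t. norm (y t - z)) \<longlongrightarrow> l) at_top"
proof -
  obtain k l where k: "(G \<longlongrightarrow> k) at_top" and l: "(H \<longlongrightarrow> l) at_top"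
    using G_convergent H_convergent by blast
  define c where "c = m * (lam - m) / 2"
  have c: "c > 0" using m_pos m_less by (simp add: c_def)
  have "\<forall>\<^sub>F t in at_top. G t < k + 1"
    using k by (rule order_tendstoD) simp
  then have "\<forall>\<^sub>F t in at_top. norm (y t - z) \<le> sqrt ((k + 1) / c)"
    using eventually_gt_at_top[of t0]
  proof eventually_elim
    case (elim t)
    then have "(norm (y t - z))\<^sup>2 \<le> (k + 1) / c"
      using G_ge_dist[OF elim(2), folded c_def] c by (simp add: field_simps)
    then show ?case by (rule real_le_rsqrt)
  qed
  then have "Bfun (\<lambda>t. y t - z) at_top" by (rule BfunI)
  moreover have "(u \<longlongrightarrow> 0) at_top"
    using norm_u_tendsto_0 by (rule tendsto_norm_zero_cancel)
  ultimately have "((\<lambda>t. u t \<bullet> (y t - z)) \<longlongrightarrow> 0) at_top"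
    using bounded_bilinear.Zfun_prod_Bfun[OF bounded_bilinear_inner, of u at_top "\<lambda>t. y t - z"]
    by (simp add: tendsto_Zfun_iff)
  with l have "((\<lambda>t. 2 / lam * (H t - u t \<bullet> (y t - z))) \<longlongrightarrow> 2 / lam * (l - 0)) at_top"
    by (intro tendsto_intros)
  moreover have "2 / lam * (H t - u t \<bullet> (y t - z)) = (norm (y t - z))\<^sup>2" for t
    using lam_pos by (simp add: H_def)
  ultimately have "((\<lambda>t. (norm (y t - z))\<^sup>2) \<longlongrightarrow> 2 / lam * (l - 0)) at_top" by simp
  from tendsto_real_sqrt[OF this] show ?thesis by auto
qed

text \<open>Monotonicity keeps \<open>b\<close> above a positive constant, so \<open>gap\<close>
  inherits the limit of \<open>b * W\<close>.\<close>

lemma gap_tendsto_0: "(gap \<longlongrightarrow> 0) at_top"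
proof (rule tendsto_sandwich[OF _ _ tendsto_const])
  define T where "T = t0 + 1"
  have T: "T > t0" by (simp add: T_def)
  show "((\<lambda>t. (b t * W t) / b T) \<longlongrightarrow> 0) at_top"
    using tendsto_divide[OF b_W_tendsto_0 tendsto_const[of "b T"]] b_pos[OF T] by simp
  show "\<forall>\<^sub>F t in at_top. gap t \<le> (b t * W t) / b T"
    using eventually_ge_at_top[of T]
  proof eventually_elim
    case (elim t)
    have "b T \<le> b t" by (rule b_mono[OF T elim])
    then have "b T * gap t \<le> b t * gap t"
      by (intro mult_right_mono gap_nonneg)
    also have "\<dots> \<le> b t * W t" using elim T by (simp add: b_W)
    finally show ?case using b_pos[OF T] by (simp add: field_simps)
  qed
  show "\<forall>\<^sub>F t in at_top. 0 \<le> gap t" by (simp add: gap_nonneg)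
qed

text \<open>The tangent at \<open>x\<close> is an affine minorant of \<open>f\<close>, and affine
  functions pass to weak limits.\<close>

lemma weak_cluster_point_minimal:
  assumes F: "F \<le> at_top" "F \<noteq> bot" and weak: "weakly_tendsto y x F"
  shows "f x \<le> f z"
proof -
  have "((\<lambda>t. f x + g x \<bullet> (y t - x)) \<longlongrightarrow> f x + (g x \<bullet> x - g x \<bullet> x)) F"
    unfolding inner_diff_right
    by (intro tendsto_add tendsto_diff tendsto_const
        weak[unfolded weakly_tendsto_def, rule_format] bounded_linear_inner_right)
  moreover have "((\<lambda>t. gap t + f z) \<longlongrightarrow> 0 + f z) F"
    by (intro tendsto_intros tendsto_mono[OF F(1) gap_tendsto_0])
  moreover have "f x + g x \<bullet> (y t - x) \<le> gap t + f z" for t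
    using convex_on_gderiv_above_tangent[OF convex gderiv_f[of x], of "y t"] by (simp add: gap_def)
  ultimately show ?thesis
    using tendsto_le[OF F(2)] by fastforce
qed

end

section \<open>Application to solutions of the equation\<close>

lemma has_vector_derivative_time_deriv:
  assumes "y differentiable_on {t0..}" and "t > t0"
  shows "(y has_vector_derivative time_deriv t0 y t) (at t)"
proof -
  have "(y has_vector_derivative time_deriv t0 y t) (at t within {t0..})"
    using assms unfolding time_deriv_def differentiable_on_def
    by (simp add: vector_derivative_works[symmetric])
  moreover have "at t within {t0..} = at t"
    using assms(2) by (intro at_within_interior) simp
  ultimately show ?thesis by simp
qed

theorem theorem2p3:
  fixes f :: "'h::{real_inner, complete_space} \<Rightarrow> real"
    and b :: "real \<Rightarrow> real"
    and y :: "real \<Rightarrow> 'h"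
    and t0 lam :: real
  assumes "convex_on UNIV f"
    and "continuously_differentiable f"
    and "argmin_set f \<noteq> {}"
    and "t0 \<ge> 0"
    and "lam > 0"
    and "\<forall>t\<ge>t0. b t > 0"
    and "b differentiable_on {t0..}"
    and "mono_on {t0..} b"
    and "bdd_above ((\<lambda>t. time_deriv t0 b t / b t) ` {t0..})"
    and "(SUP t\<in>{t0..}. time_deriv t0 b t / b t) < lam"
    and "is_solution f lam b t0 y"
  shows "(energy f b t0 y \<in> o(\<lambda>t. 1 / integral {(t + t0) / 2..t} b) \<and>
          (\<lambda>t. f (y t) - (INF x. f x)) \<in> o(\<lambda>t. 1 / integral {(t + t0) / 2..t} b) \<and>
          (\<lambda>t. norm (time_deriv t0 y t)) \<in> o(\<lambda>t. sqrt (b t / integral {(t + t0) / 2..t} b))) \<and>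
         (\<exists>x\<in>argmin_set f. weakly_tendsto y x at_top)"
proof -
  define s where "s = (SUP t\<in>{t0..}. time_deriv t0 b t / b t)"
  \<comment> \<open>The supremum \<open>s\<close> is zero for constant \<open>b\<close>; the maximum
    with \<open>lam / 2\<close> secures \<open>m > 0\<close> and stays below
    \<open>lam\<close>.\<close>
  define m where "m = max s (lam / 2)"
  note sol = assms(11)[unfolded is_solution_def twice_continuously_differentiable_def]
  have traj: "damped_gradient_trajectory f (gradient f) b (time_deriv t0 b) y (time_deriv t0 y)
      t0 lam m z" if z: "z \<in> argmin_set f" for z
  proof
    show "convex_on UNIV f" by (rule assms(1))
    show "GDERIV f x :> gradient f x" for x
      using assms(2) unfolding continuously_differentiable_def
      by (intro gderiv_gradient) (auto simp: differentiable_def)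
    show "f z \<le> f x" for x
      using z by (simp add: argmin_set_def is_arg_min_linorder)
    show "0 < m" "m < lam" using assms(5,10) by (simp_all add: m_def s_def)
    fix t assume t: "t > t0"
    show b: "b t > 0" using assms(6) t by simp
    show b': "(b has_real_derivative time_deriv t0 b t) (at t)"
      using has_vector_derivative_time_deriv[OF assms(7) t]
      by (simp add: has_real_derivative_iff_has_vector_derivative)
    show "0 \<le> time_deriv t0 b t"
      using t by (intro mono_on_imp_deriv_nonneg[OF assms(8) b']) simp
    have "time_deriv t0 b t / b t \<le> m"
      unfolding m_def s_def using t by (intro max.coboundedI1 cSUP_upper assms(9)) simp
    then show "time_deriv t0 b t \<le> m * b t" using b by (simp add: field_simps)
    show "(y has_vector_derivative time_deriv t0 y t) (at t)"
      using sol t by (intro has_vector_derivative_time_deriv) auto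
    have "time_deriv t0 (time_deriv t0 y) t + lam *\<^sub>R time_deriv t0 y t
        + b t *\<^sub>R gradient f (y t) = 0"
      using sol t by simp
    then have "time_deriv t0 (time_deriv t0 y) t
        = - (lam *\<^sub>R time_deriv t0 y t) - b t *\<^sub>R gradient f (y t)"
      by (simp add: algebra_simps eq_neg_iff_add_eq_0)
    then show "(time_deriv t0 y has_vector_derivative
        - (lam *\<^sub>R time_deriv t0 y t) - b t *\<^sub>R gradient f (y t)) (at t)"
      using has_vector_derivative_time_deriv[of "time_deriv t0 y" t0 t] sol t by metis
  qed
  obtain z where z: "z \<in> argmin_set f" using assms(3) by blast
  interpret damped_gradient_trajectory f "gradient f" b "time_deriv t0 b" y "time_deriv t0 y"
    t0 lam m z
    by (rule traj[OF z])
  \<comment> \<open>The infimum is attained at \<open>z\<close>, which identifies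
    \<open>energy\<close> with \<open>W\<close>.\<close>
  have inf_f: "(INF x. f x) = f z"
    using minimal by (intro cInf_eq_minimum) auto
  have "energy f b t0 y = W"
    by (simp add: fun_eq_iff energy_def W_def gap_def inf_f)
  moreover have "(\<lambda>t. f (y t) - (INF x. f x)) = gap"
    by (simp add: fun_eq_iff gap_def inf_f)
  moreover have "\<exists>x\<in>argmin_set f. weakly_tendsto y x at_top"
  proof (rule opial)
    show "\<exists>l. ((\<lambda>t. norm (y t - w)) \<longlongrightarrow> l) at_top" if "w \<in> argmin_set f" for w
      by (rule damped_gradient_trajectory.dist_convergent[OF traj[OF that]])
    fix F x assume "F \<le> at_top" "F \<noteq> bot" "weakly_tendsto y x F"
    then have "f x \<le> f z" by (rule weak_cluster_point_minimal)
    then show "x \<in> argmin_set f"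
      using minimal order_trans by (auto simp: argmin_set_def is_arg_min_linorder)
  qed (use assms(3) in simp_all)
  ultimately show ?thesis
    using W_smallo gap_smallo norm_u_smallo by simp
qed

end
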